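(* Let $p(\mathbf{x},\mathbf{z})=p(\mathbf{z}|\mathbf{x})p(\mathbf{x})$ be a joint density with $\mathbf{z}$ fixed and $\mathbf{x}\in\mathbb{R}^n$. For $\boldsymbol{\alpha}=(\boldsymbol{\mu},\Sigma^{-1})$ with $\boldsymbol{\mu}\in\mathbb{R}^n$ and $\Sigma\succ0$, let $q(\mathbf{x};\boldsymbol{\alpha})$ be the Gaussian density with mean $\boldsymbol{\mu}$ and covariance $\Sigma$, and let $V(\mathbf{x};\boldsymbol{\alpha})=\log q(\mathbf{x};\boldsymbol{\alpha})-\log p(\mathbf{x},\mathbf{z})$. Let $\boldsymbol{\alpha}_t=(\boldsymbol{\mu}_t,\Sigma_t^{-1})$ evolve according to the Gaussian Fisher-Rao parameter flow $$\frac{d\boldsymbol{\mu}_t}{dt}=-\Sigma_t\,\mathbb{E}_{q(\mathbf{x};\boldsymbol{\alpha}_t)}[\nabla_{\mathbf{x}}V(\mathbf{x};\boldsymbol{\alpha}_t)],\qquad \frac{d\Sigma_t^{-1}}{dt}=\mathbb{E}_{q(\mathbf{x};\boldsymbol{\alpha}_t)}[\nabla^2_{\mathbf{x}}V(\mathbf{x};\boldsymbol{\alpha}_t)].$$ Then the induced time rate of change of $q(\mathbf{x};\boldsymbol{\alpha}_t)$ satisfies the Liouville equation $$\frac{d\,q(\mathbf{x};\boldsymbol{\alpha}_t)}{dt}=-\nabla_{\mathbf{x}}\cdot\big(q(\mathbf{x};\boldsymbol{\alpha}_t)\,\tilde\phi(\mathbf{x},t)\big)$$ with particle dynamics function $\tilde\phi(\mathbf{x},t)=\tilde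 A_t\mathbf{x}+\tilde{\mathbf{b}}_t$, where $$\tilde A_t=-\tfrac12\Sigma_t\,\mathbb{E}_{q(\mathbf{x};\boldsymbol{\alpha}_t)}[\nabla^2_{\mathbf{x}}V(\mathbf{x};\boldsymbol{\alpha}_t)],\qquad \tilde{\mathbf{b}}_t=-\Sigma_t\,\mathbb{E}_{q(\mathbf{x};\boldsymbol{\alpha}_t)}[\nabla_{\mathbf{x}}V(\mathbf{x};\boldsymbol{\alpha}_t)]-\tilde A_t\boldsymbol{\mu}_t.$$
   Context: $\nabla_{\mathbf{x}}\cdot$ is the divergence, $\nabla_{\mathbf{x}}$ and $\nabla^2_{\mathbf{x}}$ are gradient and Hessian in $\mathbf{x}$ only (with $\boldsymbol{\alpha}_t$ held fixed). It is implicitly assumed that $p(\mathbf{x},\mathbf{z})>0$ is twice continuously differentiable in $\mathbf{x}$, that the Gaussian expectations are finite, and that the parameter flow is considered on a time interval on which a solution with $\Sigma_t\succ0$ exists. *)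

theory Defs
  imports "HOL-Analysis.Analysis"
begin

definition gradient :: "(real ^ 'n \<Rightarrow> real) \<Rightarrow> real ^ 'n \<Rightarrow> real ^ 'n" where
  "gradient f x = (\<chi> i. frechet_derivative f (at x) (axis i 1))"

definition hessian :: "(real ^ 'n \<Rightarrow> real) \<Rightarrow> real ^ 'n \<Rightarrow> real ^ 'n ^ 'n" where
  "hessian f x = jacobian (gradient f) (at x)"

definition divergence :: "(real ^ 'n \<Rightarrow> real ^ 'n) \<Rightarrow> real ^ 'n \<Rightarrow> real" where
  "divergence F x = (\<Sum>i\<in>UNIV. jacobian F (at x) $ i $ i)"

definition twice_continuously_differentiable :: "(real ^ 'n \<Rightarrow> real) \<Rightarrow> bool" where
  "twice_continuously_differentiable f \<longleftrightarrow>
     f differentiable_on UNIV \<and> gradient f differentiable_on UNIV \<and> continuous_on UNIV (hessian f)"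

definition positive_definite :: "real ^ 'n ^ 'n \<Rightarrow> bool" where
  "positive_definite A \<longleftrightarrow> transpose A = A \<and> (\<forall>x. x \<noteq> 0 \<longrightarrow> 0 < x \<bullet> (A *v x))"

definition prob_density :: "'a measure \<Rightarrow> ('a \<Rightarrow> real) \<Rightarrow> bool" where
  "prob_density M f \<longleftrightarrow>
     f \<in> borel_measurable M \<and> (\<forall>x\<in>space M. 0 \<le> f x) \<and> (\<integral>\<^sup>+x. ennreal (f x) \<partial>M) = 1"

definition mvn_density :: "real ^ 'n \<Rightarrow> real ^ 'n ^ 'n \<Rightarrow> real ^ 'n \<Rightarrow> real" where
  "mvn_density \<mu> \<Sigma> x =
     exp (- (1/2) * ((x - \<mu>) \<bullet> (matrix_inv \<Sigma> *v (x - \<mu>)))) / sqrt ((2 * pi) ^ CARD('n) * det \<Sigma>)"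

text \<open>The parameter is the pair of the mean and the \<^emph>\<open>precision\<close> (inverse covariance) matrix.\<close>

type_synonym 'n gauss_param = "(real ^ 'n) \<times> (real ^ 'n ^ 'n)"

definition gauss_q :: "real ^ 'n \<Rightarrow> 'n::finite gauss_param \<Rightarrow> real" where
  "gauss_q x \<alpha> = mvn_density (fst \<alpha>) (matrix_inv (snd \<alpha>)) x"

definition gauss_measure :: "'n::finite gauss_param \<Rightarrow> (real ^ 'n) measure" where
  "gauss_measure \<alpha> = density lborel (\<lambda>x. ennreal (gauss_q x \<alpha>))"

definition gauss_expectation ::
    "'n::finite gauss_param \<Rightarrow> (real ^ 'n \<Rightarrow> 'b::{banach, second_countable_topology}) \<Rightarrow> 'b" where
  "gauss_expectation \<alpha> f = (\<integral>x. f x \<partial>gauss_measure \<alpha>)"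

text \<open>Here \<open>f\<close> is the joint density with the second argument held fixed.\<close>

definition potential :: "(real ^ 'n \<Rightarrow> real) \<Rightarrow> 'n::finite gauss_param \<Rightarrow> real ^ 'n \<Rightarrow> real" where
  "potential f \<alpha> x = ln (gauss_q x \<alpha>) - ln (f x)"

end

theory Submission
  imports Defs
begin

text \<open>
  With \<open>P = \<Sigma>\<^sup>-\<^sup>1\<close>, \<open>m = d\<mu>/dt\<close>, \<open>H = dP/dt\<close> and \<open>y = x - \<mu>\<close>, Jacobi's formula for the derivative of
  \<open>det P\<close> gives \<open>dq/dt = q (tr (\<Sigma> H) / 2 - y \<bullet> H y / 2 + P y \<bullet> m)\<close>. The velocity field is
  \<open>m - \<Sigma> H y / 2\<close>, and since \<open>P\<close> is symmetric and \<open>\<nabla>q = - q P y\<close>, minus the divergence of \<open>q\<close> times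
  this field is the same expression.
\<close>

section \<open>Matrix inverses and positive definiteness\<close>

lemma matrix_inv_cancel:
  fixes A :: "'a::semiring_1^'n^'m"
  assumes "invertible A"
  shows "A ** matrix_inv A = mat 1" and "matrix_inv A ** A = mat 1"
proof -
  have "\<exists>B. A ** B = mat 1 \<and> B ** A = mat 1"
    using assms by (simp add: invertible_def)
  from someI_ex[OF this] show "A ** matrix_inv A = mat 1" and "matrix_inv A ** A = mat 1"
    by (simp_all add: matrix_inv_def)
qed

lemma matrix_inv_eqI:
  fixes A :: "'a::semiring_1^'n^'m"
  assumes "A ** B = mat 1" "B ** A = mat 1"
  shows "matrix_inv A = B"
proof -
  have "invertible A" using assms by (auto simp: invertible_def)
  then have "matrix_inv A = matrix_inv A ** (A ** B)"
    by (simp add: assms)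
  also have "\<dots> = B"
    by (simp add: matrix_mul_assoc matrix_inv_cancel \<open>invertible A\<close>)
  finally show ?thesis .
qed

lemma matrix_inv_matrix_inv:
  fixes A :: "'a::semiring_1^'n^'m"
  assumes "invertible A"
  shows "matrix_inv (matrix_inv A) = A"
  using assms by (intro matrix_inv_eqI matrix_inv_cancel)

lemma invertible_matrix_inv:
  fixes A :: "'a::semiring_1^'n^'m"
  assumes "invertible A"
  shows "invertible (matrix_inv A)"
  using matrix_inv_cancel[OF assms] by (auto simp: invertible_def)

lemma transpose_matrix_inv:
  fixes A :: "'a::comm_semiring_1^'n^'n"
  assumes "invertible A"
  shows "transpose (matrix_inv A) = matrix_inv (transpose A)"
  by (rule matrix_inv_eqI[symmetric])
    (simp_all add: matrix_inv_cancel assms flip: matrix_transpose_mul)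

lemma det_matrix_inv:
  fixes A :: "real^'n^'n"
  assumes "invertible A"
  shows "det (matrix_inv A) = inverse (det A)"
  using arg_cong[OF matrix_inv_cancel(1)[OF assms], of det]
  by (simp add: det_mul inverse_unique)

text \<open>The kernel is trivial: \<open>A *v x = 0\<close> would make the quadratic form vanish at
  \<open>x\<close>, which positivity forbids unless \<open>x = 0\<close>.\<close>

lemma positive_definite_invertible:
  assumes "positive_definite A"
  shows "invertible A"
  unfolding invertible_left_inverse matrix_left_invertible_ker
  using assms by (metis inner_zero_right less_irrefl positive_definite_def)

section \<open>The derivative of the determinant\<close>

lemma permutes_eq_id_if_fixes_all_but_one:
  assumes "p permutes UNIV" and "\<And>j. j \<noteq> i \<Longrightarrow> p j = j"
  shows "p = id"
proof -
  \<comment> \<open>The preimage of \<open>i\<close> under \<open>p\<close> must be \<open>i\<close>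
    itself: any other point is fixed, hence not sent to \<open>i\<close>.\<close>
  have "p i = i"
    using assms by (metis permutes_inverses(1))
  with assms(2) show ?thesis by (metis eq_id_iff)
qed

text \<open>In finite dimension bilinear maps are bounded. This and the next lemma make the generic
  product rule and the scalar and sign rules available for matrix products.\<close>

lemma bounded_bilinear_matrix_mult:
  "bounded_bilinear ((**) :: real^'n^'m \<Rightarrow> real^'k^'n \<Rightarrow> real^'k^'m)"
  unfolding bilinear_conv_bounded_bilinear[symmetric] bilinear_def linear_iff
  by (simp add: vec_eq_iff matrix_matrix_mult_def sum.distrib sum_distrib_left algebra_simps)

lemma bounded_bilinear_matrix_vector_mult:
  "bounded_bilinear ((*v) :: real^'n^'m \<Rightarrow> real^'n \<Rightarrow> real^'m)"
  unfolding bilinear_conv_bounded_bilinear[symmetric] bilinear_def linear_iff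
  by (simp add: vec_eq_iff matrix_vector_mult_def sum.distrib sum_distrib_left algebra_simps)

lemma has_vector_derivative_vec_nth:
  assumes "(f has_vector_derivative f') F"
  shows "((\<lambda>x. f x $ i) has_vector_derivative f' $ i) F"
  using bounded_linear.has_vector_derivative[OF bounded_linear_vec_nth assms] .

text \<open>Jacobi's formula at the identity matrix. Differentiating the Leibniz expansion replaces
  one factor of each product by its derivative; at the identity only the diagonal product survives,
  and it contributes the sum of the diagonal entries of \<open>B'\<close>.\<close>

lemma has_real_derivative_det_at_one:
  fixes B :: "real \<Rightarrow> real^'n^'n"
  assumes B: "(B has_vector_derivative B') (at t within S)" and "B t = mat 1"
  shows "((\<lambda>s. det (B s)) has_real_derivative trace B') (at t within S)"
proof -
  have entry: "((\<lambda>s. B s $ i $ j) has_derivative (\<lambda>h. h * B' $ i $ j)) (at t within S)" for i j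
    using has_vector_derivative_vec_nth[OF has_vector_derivative_vec_nth[OF B]]
    by (simp add: has_vector_derivative_def)
  \<comment> \<open>\<open>?c p\<close> is the contribution of the permutation \<open>p\<close> to
    the derivative.\<close>
  let ?c = "\<lambda>p. of_int (sign p) * (\<Sum>i\<in>UNIV. B' $ i $ p i * (\<Prod>j\<in>UNIV - {i}. B t $ j $ p j))"
  have "((\<lambda>s. det (B s)) has_derivative
      (\<lambda>h. \<Sum>p | p permutes (UNIV::'n set). of_int (sign p) *
        (\<Sum>i\<in>UNIV. h * B' $ i $ p i * (\<Prod>j\<in>UNIV - {i}. B t $ j $ p j)))) (at t within S)"
    unfolding det_def
    by (intro has_derivative_sum has_derivative_mult_right has_derivative_prod entry)
  then have det: "((\<lambda>s. det (B s)) has_derivative (\<lambda>h. h * (\<Sum>p | p permutes (UNIV::'n set). ?c p)))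
      (at t within S)"
    by (simp only: sum_distrib_left mult_ac)
  have c: "?c p = (if p = id then trace B' else 0)" if p: "p permutes (UNIV::'n set)" for p
  proof (cases "p = id")
    case True
    then show ?thesis by (simp add: assms(2) mat_def trace_def sign_id)
  next
    case False
    \<comment> \<open>A permutation other than \<open>id\<close> moves at least two points, so even
      with the factor at \<open>i\<close> left out an off-diagonal entry of the identity matrix
      remains.\<close>
    have zero: "(\<Prod>j\<in>UNIV - {i}. B t $ j $ p j) = 0" for i
    proof -
      obtain j where "j \<noteq> i" "p j \<noteq> j"
        using permutes_eq_id_if_fixes_all_but_one[OF p] False by blast
      then show ?thesis
        by (intro prod_zero) (auto simp: assms(2) mat_def intro!: bexI[of _ j])
    qed
    from False show ?thesis
      by (simp only: zero if_False mult_zero_right sum.neutral_const)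
  qed
  have "(\<Sum>p | p permutes (UNIV::'n set). ?c p)
      = (\<Sum>p | p permutes (UNIV::'n set). if p = id then trace B' else 0)"
    by (rule sum.cong[OF refl c]) simp
  then have "(\<Sum>p | p permutes (UNIV::'n set). ?c p) = trace B'"
    by (simp only: sum.delta finite_permutations finite mem_Collect_eq permutes_id if_True)
  with det show ?thesis
    by (simp only: has_field_derivative_def mult_commute_abs)
qed

text \<open>The curve \<open>matrix_inv (B t) ** B s\<close> passes through the identity at
  \<open>s = t\<close>, which reduces the claim to the previous lemma; multiplicativity of
  \<open>det\<close> then restores the factor \<open>det (B t)\<close>.\<close>

lemma has_real_derivative_det:
  fixes B :: "real \<Rightarrow> real^'n^'n"
  assumes B: "(B has_vector_derivative B') (at t within S)" and inv: "invertible (B t)"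
  shows "((\<lambda>s. det (B s)) has_real_derivative det (B t) * trace (matrix_inv (B t) ** B'))
    (at t within S)"
proof -
  have "((\<lambda>s. matrix_inv (B t) ** B s) has_vector_derivative matrix_inv (B t) ** B') (at t within S)"
    using bounded_linear.has_vector_derivative
      [OF bounded_bilinear.bounded_linear_right[OF bounded_bilinear_matrix_mult] B] .
  then have "((\<lambda>s. det (matrix_inv (B t) ** B s)) has_real_derivative trace (matrix_inv (B t) ** B'))
      (at t within S)"
    by (rule has_real_derivative_det_at_one) (simp add: matrix_inv_cancel inv)
  from DERIV_cmult[OF this, of "det (B t)"] show ?thesis
    using inv by (simp add: det_mul det_matrix_inv invertible_det_nz flip: mult.assoc)
qed

section \<open>Divergence of a scalar function times a vector field\<close>

lemma divergence_eq_trace: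
  assumes "(F has_derivative F') (at x)"
  shows "divergence F x = (\<Sum>i\<in>UNIV. F' (axis i 1) $ i)"
  using frechet_derivative_at[OF assms]
  by (simp add: divergence_def jacobian_def matrix_def)

text \<open>The product rule div(gF) = g div F + grad g . F, where \<open>G\<close> is the gradient
  of \<open>g\<close> at \<open>x\<close> and the divergence of \<open>F\<close> there is the trace
  of its Jacobian \<open>A\<close>.\<close>

lemma divergence_scaleR:
  fixes g :: "real^'n \<Rightarrow> real" and F :: "real^'n \<Rightarrow> real^'n"
  assumes g: "(g has_derivative (\<lambda>h. G \<bullet> h)) (at x)" and F: "(F has_derivative (*v) A) (at x)"
  shows "divergence (\<lambda>y. g y *\<^sub>R F y) x = g x * trace A + G \<bullet> F x"
proof -
  have "divergence (\<lambda>y. g y *\<^sub>R F y) x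
      = (\<Sum>i\<in>UNIV. (g x *\<^sub>R (A *v axis i 1) + (G \<bullet> axis i 1) *\<^sub>R F x) $ i)"
    by (rule divergence_eq_trace has_derivative_scaleR g F)+
  also have "\<dots> = g x * trace A + G \<bullet> F x"
    by (simp add: trace_def inner_vec_def[of G "F x"] inner_axis matrix_vector_mult_basis column_def
        sum.distrib sum_distrib_left)
  finally show ?thesis .
qed

section \<open>The Gaussian density: derivatives in space and time, and the Liouville
  equation\<close>

lemma inner_symmetric_matrix:
  fixes P :: "real^'n^'n"
  assumes "transpose P = P"
  shows "u \<bullet> (P *v v) = (P *v u) \<bullet> v"
  using assms by (metis dot_lmul_matrix vector_transpose_matrix)

text \<open>Eliminates both inversions hidden in \<open>gauss_q\<close>, so that the density can be
  differentiated along a curve of precision matrices without differentiating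
  \<open>matrix_inv\<close>.\<close>

lemma gauss_q_eq:
  fixes P :: "real^'n^'n"
  assumes "invertible P"
  shows "gauss_q x (m, P) =
    exp (- (1/2) * ((x - m) \<bullet> (P *v (x - m)))) * sqrt (det P) / sqrt ((2 * pi) ^ CARD('n))"
proof -
  have "sqrt ((2 * pi) ^ CARD('n) * inverse (det P))
      = sqrt ((2 * pi) ^ CARD('n)) * inverse (sqrt (det P))"
    by (simp only: real_sqrt_mult real_sqrt_inverse)
  with assms show ?thesis
    by (simp only: gauss_q_def mvn_density_def matrix_inv_matrix_inv det_matrix_inv fst_conv snd_conv)
      (simp add: field_simps)
qed

lemma gauss_q_has_derivative:
  fixes P :: "real^'n^'n"
  assumes inv: "invertible P" and sym: "transpose P = P"
  shows "((\<lambda>x. gauss_q x (m, P)) has_derivative (\<lambda>h. (- gauss_q x (m, P) *\<^sub>R (P *v (x - m))) \<bullet> h))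
    (at x)"
proof -
  have P: "((\<lambda>x. P *v (x - m)) has_derivative (\<lambda>h. P *v h)) (at x)"
    by (rule bounded_linear.has_derivative[OF matrix_vector_mul_bounded_linear])
      (auto intro!: derivative_eq_intros)
  have r: "((\<lambda>x. x - m) has_derivative (\<lambda>h. h)) (at x)"
    by (auto intro!: derivative_eq_intros)
  have "((\<lambda>x. (x - m) \<bullet> (P *v (x - m))) has_derivative
      (\<lambda>h. (x - m) \<bullet> (P *v h) + h \<bullet> (P *v (x - m)))) (at x)"
    by (rule has_derivative_inner r P)+
  \<comment> \<open>Symmetry of \<open>P\<close> makes the two terms of the product rule equal; the
    resulting 2 cancels the 1/2 in the exponent.\<close>
  moreover have "(x - m) \<bullet> (P *v h) + h \<bullet> (P *v (x - m)) = 2 * ((P *v (x - m)) \<bullet> h)" for h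
    using inner_symmetric_matrix[OF sym, of "x - m" h] by (simp add: inner_commute[of h])
  ultimately have "((\<lambda>x. (x - m) \<bullet> (P *v (x - m))) has_derivative
      (\<lambda>h. 2 * ((P *v (x - m)) \<bullet> h))) (at x)"
    by simp
  then have "((\<lambda>x. exp (- (1/2) * ((x - m) \<bullet> (P *v (x - m))))) has_derivative
      (\<lambda>h. - (1/2) * (2 * ((P *v (x - m)) \<bullet> h)) * exp (- (1/2) * ((x - m) \<bullet> (P *v (x - m))))))
      (at x)"
    by (rule has_derivative_exp[OF has_derivative_mult_right])
  from has_derivative_mult_left[OF this, of "sqrt (det P) / sqrt ((2 * pi) ^ CARD('n))"]
  show ?thesis
    unfolding gauss_q_eq[OF inv] by (simp add: algebra_simps)
qed

lemma gauss_q_has_real_derivative: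
  fixes P :: "real \<Rightarrow> real^'n^'n" and x :: "real^'n"
  assumes \<mu>: "(\<mu> has_vector_derivative m) (at t within T)"
    and P: "(P has_vector_derivative H) (at t within T)"
    and inv: "\<And>s. s \<in> T \<Longrightarrow> invertible (P s)" and sym: "transpose (P t) = P t" and "t \<in> T"
  defines "y \<equiv> x - \<mu> t"
  shows "((\<lambda>s. gauss_q x (\<mu> s, P s)) has_real_derivative
      gauss_q x (\<mu> t, P t) *
        (trace (matrix_inv (P t) ** H) / 2 - y \<bullet> (H *v y) / 2 + (P t *v y) \<bullet> m))
    (at t within T)"
proof -
  let ?q = "\<lambda>s. exp (- (1/2) * ((x - \<mu> s) \<bullet> (P s *v (x - \<mu> s)))) * sqrt (det (P s))
    / sqrt ((2 * pi) ^ CARD('n))"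
  let ?d = "det (P t)"
  have d: "?d \<noteq> 0"
    using inv[OF \<open>t \<in> T\<close>] by (simp add: invertible_det_nz)
  have sqrt: "((\<lambda>s. sqrt (det (P s))) has_real_derivative
      sqrt ?d * (trace (matrix_inv (P t) ** H) / 2)) (at t within T)"
  proof -
    \<comment> \<open>The library's \<open>sqrt\<close> is odd, so \<open>?d \<noteq> 0\<close> suffices here.\<close>
    have "DERIV sqrt ?d :> sqrt ?d / (2 * ?d)"
      using d by (intro DERIV_real_sqrt_generic) (auto simp: field_simps)
    from DERIV_chain2[OF this has_real_derivative_det[OF P inv[OF \<open>t \<in> T\<close>]]] d
    show ?thesis by (simp add: field_simps)
  qed
  have r: "((\<lambda>s. x - \<mu> s) has_vector_derivative - m) (at t within T)"
    using \<mu> by (auto intro!: derivative_eq_intros)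
  have "((\<lambda>s. (x - \<mu> s) \<bullet> (P s *v (x - \<mu> s))) has_vector_derivative
      (y \<bullet> (P t *v (- m) + H *v y) + (- m) \<bullet> (P t *v y))) (at t within T)"
    unfolding y_def
    by (intro bounded_bilinear.has_vector_derivative[OF bounded_bilinear_inner]
        bounded_bilinear.has_vector_derivative[OF bounded_bilinear_matrix_vector_mult] r P)
  \<comment> \<open>The motion of the mean enters through both arguments of the quadratic form; by
    symmetry of \<open>P t\<close> the two cross terms coincide.\<close>
  then have quad: "((\<lambda>s. (x - \<mu> s) \<bullet> (P s *v (x - \<mu> s))) has_real_derivative
      (y \<bullet> (H *v y) - 2 * ((P t *v y) \<bullet> m))) (at t within T)"
    using inner_symmetric_matrix[OF sym, of y m]
    by (simp add: has_real_derivative_iff_has_vector_derivative inner_diff_right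
        vec.neg inner_commute[of m] inner_commute[of _ "P t *v y"] algebra_simps)
  have exp: "((\<lambda>s. exp (- (1/2) * ((x - \<mu> s) \<bullet> (P s *v (x - \<mu> s))))) has_real_derivative
      exp (- (1/2) * (y \<bullet> (P t *v y))) * (- (1/2) * (y \<bullet> (H *v y) - 2 * ((P t *v y) \<bullet> m))))
    (at t within T)"
    using DERIV_chain2[OF DERIV_exp DERIV_cmult[OF quad]] by (simp only: y_def)
  have "(?q has_real_derivative
      ?q t * (trace (matrix_inv (P t) ** H) / 2 - y \<bullet> (H *v y) / 2 + (P t *v y) \<bullet> m))
    (at t within T)"
    by (rule DERIV_cong[OF DERIV_cdivide[OF DERIV_mult[OF exp sqrt]]])
      (simp add: y_def[symmetric] field_simps)
  \<comment> \<open>The closed form \<open>?q s\<close> is known to equal the density only where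
    \<open>P s\<close> is invertible, so the derivative is transferred within \<open>T\<close>; the
    radius 1 of the neighbourhood is arbitrary.\<close>
  then show ?thesis
    using has_field_derivative_transform_within[OF _ zero_less_one \<open>t \<in> T\<close>]
    by (smt (verit) gauss_q_eq inv \<open>t \<in> T\<close>)
qed

text \<open>A purely kinematic fact: \<open>m\<close> and \<open>H\<close> are the derivatives of an
  arbitrary curve of means and precisions. The Fisher-Rao values are inserted only in the
  theorem.\<close>

lemma gauss_q_liouville:
  fixes P :: "real \<Rightarrow> real^'n^'n"
  assumes \<mu>: "(\<mu> has_vector_derivative m) (at t within T)"
    and P: "(P has_vector_derivative H) (at t within T)"
    and inv: "\<And>s. s \<in> T \<Longrightarrow> invertible (P s)" and sym: "transpose (P t) = P t" and "t \<in> T"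
  defines "A \<equiv> - (1/2) *\<^sub>R (matrix_inv (P t) ** H)"
  shows "((\<lambda>s. gauss_q x (\<mu> s, P s)) has_real_derivative
      - divergence (\<lambda>y. gauss_q y (\<mu> t, P t) *\<^sub>R (A *v y + (m - A *v \<mu> t))) x)
    (at t within T)"
proof -
  let ?q = "gauss_q x (\<mu> t, P t)" and ?y = "x - \<mu> t"
  have "((\<lambda>y. A *v y + (m - A *v \<mu> t)) has_derivative (*v) A) (at x)"
    by (auto intro!: derivative_eq_intros bounded_linear_imp_has_derivative)
  then have "divergence (\<lambda>y. gauss_q y (\<mu> t, P t) *\<^sub>R (A *v y + (m - A *v \<mu> t))) x
      = ?q * trace A + (- ?q *\<^sub>R (P t *v ?y)) \<bullet> (A *v x + (m - A *v \<mu> t))"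
    by (rule divergence_scaleR[OF gauss_q_has_derivative[OF inv[OF \<open>t \<in> T\<close>] sym]])
  \<comment> \<open>Centring at the mean separates the translation \<open>m\<close> from the linear
    part acting on \<open>?y\<close>.\<close>
  also have "A *v x + (m - A *v \<mu> t) = m + A *v ?y"
    by (simp add: matrix_vector_mult_diff_distrib)
  also have "trace A = - trace (matrix_inv (P t) ** H) / 2"
    by (simp add: A_def trace_def sum_divide_distrib sum_negf)
  also have "(- ?q *\<^sub>R (P t *v ?y)) \<bullet> (m + A *v ?y)
      = - ?q * ((P t *v ?y) \<bullet> m + (P t *v ?y) \<bullet> (A *v ?y))"
    by (simp add: inner_add_right algebra_simps)
  \<comment> \<open>Moving \<open>P t\<close> across the inner product by symmetry lets it cancel
    the inverse in \<open>A\<close>, leaving \<open>H\<close> with factor -1/2.\<close>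
  also have "(P t *v ?y) \<bullet> (A *v ?y) = - (?y \<bullet> (H *v ?y)) / 2"
  proof -
    have "(P t *v ?y) \<bullet> (A *v ?y) = ?y \<bullet> ((P t ** A) *v ?y)"
      by (simp add: inner_symmetric_matrix[OF sym] matrix_vector_mul_assoc[symmetric])
    also have "P t ** A = - (1/2) *\<^sub>R H"
      unfolding A_def
      by (simp add: bounded_bilinear.scaleR_right[OF bounded_bilinear_matrix_mult] matrix_mul_assoc
          matrix_inv_cancel inv \<open>t \<in> T\<close> bounded_bilinear.minus_right[OF bounded_bilinear_matrix_mult])
    finally show ?thesis
      by (simp add: scaleR_matrix_vector_assoc[symmetric]
          bounded_bilinear.minus_left[OF bounded_bilinear_matrix_vector_mult])
  qed
  finally have div: "divergence (\<lambda>y. gauss_q y (\<mu> t, P t) *\<^sub>R (A *v y + (m - A *v \<mu> t))) x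
      = ?q * (- trace (matrix_inv (P t) ** H) / 2)
        + - ?q * ((P t *v ?y) \<bullet> m + - (?y \<bullet> (H *v ?y)) / 2)" .
  show ?thesis
    unfolding div
    by (rule DERIV_cong[OF gauss_q_has_real_derivative[OF \<mu> P inv sym \<open>t \<in> T\<close>]])
      (simp_all add: field_simps)
qed

theorem lemma4:
  fixes N :: "'z measure"
    and prior :: "real ^ 'n \<Rightarrow> real"
    and lik :: "'z \<Rightarrow> real ^ 'n \<Rightarrow> real"
    and p :: "real ^ 'n \<Rightarrow> 'z \<Rightarrow> real"
    and z :: 'z
    and T :: "real set"
    and \<mu> :: "real \<Rightarrow> real ^ 'n"
    and \<Sigma> :: "real \<Rightarrow> real ^ 'n ^ 'n"
    and \<alpha> :: "real \<Rightarrow> 'n gauss_param"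
    and V :: "real ^ 'n \<Rightarrow> 'n gauss_param \<Rightarrow> real"
    and A :: "real \<Rightarrow> real ^ 'n ^ 'n"
    and b :: "real \<Rightarrow> real ^ 'n"
    and \<phi> :: "real ^ 'n \<Rightarrow> real \<Rightarrow> real ^ 'n"
  defines "p \<equiv> \<lambda>x z. lik z x * prior x"
    and "\<alpha> \<equiv> \<lambda>t. (\<mu> t, matrix_inv (\<Sigma> t))"
    and "V \<equiv> \<lambda>x a. potential (\<lambda>y. p y z) a x"
    and "A \<equiv> \<lambda>t. - (1/2) *\<^sub>R
               (\<Sigma> t ** gauss_expectation (\<alpha> t) (\<lambda>x. hessian (\<lambda>y. V y (\<alpha> t)) x))"
    and "b \<equiv> \<lambda>t. - (\<Sigma> t *v gauss_expectation (\<alpha> t) (\<lambda>x. gradient (\<lambda>y. V y (\<alpha> t)) x))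
               - A t *v \<mu> t"
    and "\<phi> \<equiv> \<lambda>x t. A t *v x + b t"
  assumes "sigma_finite_measure N" and "z \<in> space N"
    and "prob_density lborel prior"
    and "\<And>x. prob_density N (\<lambda>z. lik z x)"
    and "prob_density (lborel \<Otimes>\<^sub>M N) (\<lambda>(x, z). p x z)"
    and "\<And>x. 0 < p x z"
    and "twice_continuously_differentiable (\<lambda>x. p x z)"
    and "is_interval T"
    and "\<And>t. t \<in> T \<Longrightarrow> positive_definite (\<Sigma> t)"
    and "\<And>t. t \<in> T \<Longrightarrow> integrable (gauss_measure (\<alpha> t)) (gradient (\<lambda>y. V y (\<alpha> t)))"
    and "\<And>t. t \<in> T \<Longrightarrow> integrable (gauss_measure (\<alpha> t)) (hessian (\<lambda>y. V y (\<alpha> t)))"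
    and "\<And>t. t \<in> T \<Longrightarrow>
           (\<mu> has_vector_derivative
              - (\<Sigma> t *v gauss_expectation (\<alpha> t) (\<lambda>x. gradient (\<lambda>y. V y (\<alpha> t)) x)))
           (at t within T)"
    and "\<And>t. t \<in> T \<Longrightarrow>
           ((\<lambda>s. matrix_inv (\<Sigma> s)) has_vector_derivative
              gauss_expectation (\<alpha> t) (\<lambda>x. hessian (\<lambda>y. V y (\<alpha> t)) x))
           (at t within T)"
  shows "\<forall>t\<in>T. \<forall>x.
           ((\<lambda>s. gauss_q x (\<alpha> s)) has_real_derivative
              - divergence (\<lambda>y. gauss_q y (\<alpha> t) *\<^sub>R \<phi> y t) x)
           (at t within T)"
proof (intro ballI allI)
  fix t x assume "t \<in> T"
  let ?P = "\<lambda>s. matrix_inv (\<Sigma> s)"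
  have inv: "invertible (\<Sigma> s)" if "s \<in> T" for s
    using that assms(15) positive_definite_invertible by blast
  have "transpose (?P t) = ?P t"
    using \<open>t \<in> T\<close> assms(15) by (simp add: transpose_matrix_inv inv positive_definite_def)
  \<comment> \<open>\<open>assms(18)\<close> and \<open>assms(19)\<close> are the flow equations:
    they make \<open>m\<close> minus \<open>\<Sigma> t\<close> times the expected gradient, and
    \<open>H\<close> the expected Hessian. Then \<open>b t\<close> is
    \<open>m - A t *v \<mu> t\<close>, and inverting the precision gives back
    \<open>\<Sigma> t\<close>.\<close>
  from gauss_q_liouville[OF assms(18) assms(19) invertible_matrix_inv[OF inv] this, of x]
  show "((\<lambda>s. gauss_q x (\<alpha> s)) has_real_derivative
      - divergence (\<lambda>y. gauss_q y (\<alpha> t) *\<^sub>R \<phi> y t) x) (at t within T)"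
    using \<open>t \<in> T\<close> by (simp add: \<phi>_def b_def A_def \<alpha>_def matrix_inv_matrix_inv inv)
qed

end
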